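(* Let $(X,d)$ be a finite ultrametric space with $|X|\ge 2$. Then $(X,d)$ is nonrigid, i.e. $|\operatorname{Iso}(X)|\neq 1$.
   Context: An ultrametric space is a metric space with $d(x,y)\le\max\{d(x,z),d(z,y)\}$ for all $x,y,z$. $\operatorname{Iso}(X)$ is the group of isometries of $(X,d)$ (bijective distance-preserving maps $X\to X$). A metric space $(X,d)$ is rigid if $|\operatorname{Iso}(X)|=1$, and nonrigid otherwise. *)

theory Defs
  imports "HOL-Analysis.Abstract_Metric_Spaces" "HOL-Algebra.Bij"
begin

locale Ultrametric_space = Metric_space +
  assumes ultrametric: "\<lbrakk>x \<in> M; y \<in> M; z \<in> M\<rbrakk> \<Longrightarrow> d x y \<le> max (d x z) (d z y)"

text \<open>Elements of \<^term>\<open>Bij X\<close> are extensional, so functions that agree on the carrier are not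
  counted as distinct isometries.\<close>

definition isometries :: "'a set \<Rightarrow> ('a \<Rightarrow> 'a \<Rightarrow> real) \<Rightarrow> ('a \<Rightarrow> 'a) set" where
  "isometries X d = {f \<in> Bij X. \<forall>x\<in>X. \<forall>y\<in>X. d (f x) (f y) = d x y}"

definition Iso :: "'a set \<Rightarrow> ('a \<Rightarrow> 'a \<Rightarrow> real) \<Rightarrow> ('a \<Rightarrow> 'a) monoid" where
  "Iso X d = BijGroup X \<lparr>carrier := isometries X d\<rparr>"

lemma subgroup_isometries: "subgroup (isometries X d) (BijGroup X)"
proof -
  interpret group "BijGroup X" by (rule group_BijGroup)
  show ?thesis
  proof (rule subgroupI)
    show "isometries X d \<subseteq> carrier (BijGroup X)"
      by (auto simp: isometries_def BijGroup_def)
    have "(\<lambda>x\<in>X. x) \<in> isometries X d"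
      by (simp add: isometries_def id_Bij)
    then show "isometries X d \<noteq> {}" by blast
  next
    fix f assume f: "f \<in> isometries X d"
    then have fB: "f \<in> Bij X" by (simp add: isometries_def)
    have "d (inv_into X f x) (inv_into X f y) = d x y" if "x \<in> X" "y \<in> X" for x y
    proof -
      have "f ` X = X" using fB by (simp add: Bij_def bij_betw_def)
      then have "f (inv_into X f x) = x" "f (inv_into X f y) = y"
        using that by (simp_all add: f_inv_into_f)
      moreover have "inv_into X f x \<in> X" "inv_into X f y \<in> X"
        using fB that by (simp_all add: Bij_inv_into_mem)
      ultimately show ?thesis
        using f unfolding isometries_def by fastforce
    qed
    then show "inv\<^bsub>BijGroup X\<^esub> f \<in> isometries X d"
      using fB by (simp add: isometries_def inv_BijGroup restrict_inv_into_Bij)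
  next
    fix f g assume f: "f \<in> isometries X d" and g: "g \<in> isometries X d"
    then have B: "f \<in> Bij X" "g \<in> Bij X" by (simp_all add: isometries_def)
    then have "compose X f g \<in> Bij X" by (rule compose_Bij)
    moreover have "d (compose X f g x) (compose X f g y) = d x y" if "x \<in> X" "y \<in> X" for x y
      using f g that B(2)[THEN Bij_imp_funcset] by (simp add: isometries_def compose_eq funcset_mem)
    ultimately show "f \<otimes>\<^bsub>BijGroup X\<^esub> g \<in> isometries X d"
      using B by (simp add: isometries_def BijGroup_def)
  qed
qed

lemma group_Iso: "group (Iso X d)"
  unfolding Iso_def
  by (rule subgroup.subgroup_is_group[OF subgroup_isometries group_BijGroup])

definition rigid :: "'a set \<Rightarrow> ('a \<Rightarrow> 'a \<Rightarrow> real) \<Rightarrow> bool" where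
  "rigid X d \<longleftrightarrow> card (carrier (Iso X d)) = 1"

abbreviation nonrigid :: "'a set \<Rightarrow> ('a \<Rightarrow> 'a \<Rightarrow> real) \<Rightarrow> bool" where
  "nonrigid X d \<equiv> \<not> rigid X d"

end

(* Swapping two distinct points a, b at minimal distance is an isometry: every other point z has
   d a z >= d a b and d b z >= d a b, so the ultrametric inequality gives d a z = d b z. *)
theory Submission
  imports Defs "HOL-Combinatorics.Transposition"
begin

text \<open>In an ultrametric space every triangle is isosceles, its two longest sides being equal.
  If \<open>a \<noteq> b\<close> realise the smallest nonzero distance
  (\<open>closest_pair_exists\<close>), every third point is therefore equidistant from them
  (\<open>dist_eq_if_closest_pair\<close>). So exchanging \<open>a\<close> and \<open>b\<close> and
  fixing everything else preserves distances (\<open>transpose_closest_pair_isometry\<close>), which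
  gives an isometry other than the identity.\<close>

lemma (in Metric_space) closest_pair_exists:
  assumes "finite M" and "card M \<ge> 2"
  obtains a b where "a \<in> M" "b \<in> M" "a \<noteq> b"
    and "\<And>x y. \<lbrakk>x \<in> M; y \<in> M; x \<noteq> y\<rbrakk> \<Longrightarrow> d a b \<le> d x y"
proof -
  define P where "P = {(x, y) \<in> M \<times> M. x \<noteq> y}"
  have "finite P"
    by (rule finite_subset[of _ "M \<times> M"]) (auto simp: P_def assms)
  moreover have "P \<noteq> {}"
  proof
    assume "P = {}"
    then have "x = y" if "x \<in> M" "y \<in> M" for x y
      using that by (auto simp: P_def)
    then have "card M \<le> Suc 0"
      using assms(1) by (simp add: card_le_Suc0_iff_eq)
    then show False
      using assms(2) by simp
  qed
  ultimately obtain p where "is_arg_min (case_prod d) (\<lambda>p. p \<in> P) p"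
    using ex_is_arg_min_if_finite by blast
  moreover obtain a b where "p = (a, b)"
    by (rule prod.exhaust)
  ultimately have "(a, b) \<in> P" and min: "\<And>x y. (x, y) \<in> P \<Longrightarrow> d a b \<le> d x y"
    by (auto simp: is_arg_min_linorder)
  show thesis
  proof
    show "a \<in> M" "b \<in> M" "a \<noteq> b"
      using \<open>(a, b) \<in> P\<close> by (simp_all add: P_def)
    show "d a b \<le> d x y" if "x \<in> M" "y \<in> M" "x \<noteq> y" for x y
      using min that by (simp add: P_def)
  qed
qed

text \<open>Each of \<open>d a z\<close> and \<open>d b z\<close> is at most the maximum of
  \<open>d a b\<close> and the other. Minimality puts \<open>d a b\<close> below both, so it drops
  out of each maximum and the two bound each other.\<close>

lemma (in Ultrametric_space) dist_eq_if_closest_pair: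
  assumes "a \<in> M" "b \<in> M"
    and min: "\<And>x y. \<lbrakk>x \<in> M; y \<in> M; x \<noteq> y\<rbrakk> \<Longrightarrow> d a b \<le> d x y"
    and "z \<in> M" "z \<noteq> a" "z \<noteq> b"
  shows "d a z = d b z"
proof -
  have "d a z \<le> max (d a b) (d b z)" "d b z \<le> max (d a b) (d a z)"
    using ultrametric[of a z b] ultrametric[of b z a] assms(1,2,4) by (simp_all add: commute)
  moreover have "d a b \<le> d a z" "d a b \<le> d b z"
    using min assms by auto
  ultimately show ?thesis by linarith
qed

lemma (in Ultrametric_space) transpose_closest_pair_isometry:
  assumes "a \<in> M" "b \<in> M"
    and min: "\<And>x y. \<lbrakk>x \<in> M; y \<in> M; x \<noteq> y\<rbrakk> \<Longrightarrow> d a b \<le> d x y"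
  shows "restrict (Transposition.transpose a b) M \<in> isometries M d"
proof -
  have "bij_betw (Transposition.transpose a b) M M"
    using assms(1,2) by (simp add: bij_betw_def)
  then have "restrict (Transposition.transpose a b) M \<in> Bij M"
    \<comment> \<open>Members of \<open>Bij M\<close> are extensional, hence the
      \<open>restrict\<close>; the congruence rule carries bijectivity over to the restricted
      map.\<close>
    by (simp add: Bij_def cong: bij_betw_cong)
  moreover have "d (Transposition.transpose a b x) (Transposition.transpose a b y) = d x y"
    if "x \<in> M" "y \<in> M" for x y
  proof -
    have left: "d a z = d b z" if "z \<in> M" "z \<noteq> a" "z \<noteq> b" for z
      using dist_eq_if_closest_pair[OF assms] that by blast
    then have right: "d z a = d z b" if "z \<in> M" "z \<noteq> a" "z \<noteq> b" for z
      using that commute[of z a] commute[of z b] by metis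
    \<comment> \<open>Minimality matters only when exactly one of the points is moved; if both lie
      in \<open>{a, b}\<close>, symmetry and vanishing self-distances suffice.\<close>
    consider "x \<in> {a, b}" "y \<in> {a, b}" | "x \<in> {a, b}" "y \<notin> {a, b}"
      | "x \<notin> {a, b}" "y \<in> {a, b}" | "x \<notin> {a, b}" "y \<notin> {a, b}"
      by blast
    then show ?thesis
    proof cases
      case 1
      then show ?thesis using commute[of b a] assms(1,2) by auto
    next
      case 2
      then show ?thesis using left[of y] that by auto
    next
      case 3
      then show ?thesis using right[of x] that by auto
    next
      case 4
      then show ?thesis by simp
    qed
  qed
  ultimately show ?thesis
    by (simp add: isometries_def)
qed

theorem proposition3p1:
  fixes X :: "'a set" and d :: "'a \<Rightarrow> 'a \<Rightarrow> real"
  assumes "Ultrametric_space X d"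
    and "finite X"
    and "card X \<ge> 2"
  shows "nonrigid X d"
proof
  interpret Ultrametric_space X d by (fact assms(1))
  obtain a b where ab: "a \<in> X" "b \<in> X" "a \<noteq> b"
    and min: "\<And>x y. \<lbrakk>x \<in> X; y \<in> X; x \<noteq> y\<rbrakk> \<Longrightarrow> d a b \<le> d x y"
    using closest_pair_exists[OF assms(2,3)] by blast
  assume "rigid X d"
  then obtain h where "isometries X d = {h}"
    by (auto simp: rigid_def Iso_def card_1_singleton_iff)
  moreover have "restrict (Transposition.transpose a b) X \<in> isometries X d"
    by (rule transpose_closest_pair_isometry[OF ab(1,2) min])
  moreover have "(\<lambda>x\<in>X. x) \<in> isometries X d"
    by (simp add: isometries_def id_Bij)
  \<comment> \<open>Both isometries equal \<open>h\<close>, yet at \<open>a\<close> the first takes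
    the value \<open>b\<close> and the second \<open>a\<close>.\<close>
  ultimately have "restrict (Transposition.transpose a b) X a = (\<lambda>x\<in>X. x) a"
    by simp
  then show False
    using ab by simp
qed

end
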